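(* Let $\pi$ be a semigroup, $\mathcal{A}$ an algebra over $K$, $\lambda\in K$ and $\mathcal{R}:\mathcal{A}\to\mathcal{A}$ a linear map. For every $\varphi\in\pi$ define $R_\varphi:\mathcal{A}\varphi\to\mathcal{A}\varphi$ by $R_\varphi(h\varphi)=\mathcal{R}(h)\varphi$ for all $h\in\mathcal{A}$. Then $(\mathcal{A},\mathcal{R})$ is a Rota-Baxter algebra of weight $\lambda$ if and only if $(\mathcal{A}[\pi],R=\{R_\varphi\}_{\varphi\in\pi})$ is a Rota-Baxter T-algebra of weight $\lambda$.
   Context: $K$ is a field; all vector spaces, tensor products and linear maps are over $K$; algebras are associative; $\pi$ is nonempty. A Rota-Baxter algebra of weight $\lambda\in K$ is an algebra $\mathcal{A}$ with a linear map $\mathcal{R}:\mathcal{A}\to\mathcal{A}$ such that $\mathcal{R}(a)\mathcal{R}(b)=\mathcal{R}(a\mathcal{R}(b))+\mathcal{R}(\mathcal{R}(a)b)+\lambda\mathcal{R}(ab)$ for all $a,b\in\mathcal{A}$. For a semigroup $\pi$, a T-algebra is a family of vector spaces $\{A_\varphi\}_{\varphi\in\pi}$ with linear maps $\mu_{p,q}:A_p\otimes A_q\to A_{pq}$ ($p,q\in\pi$), written $\mu_{p,q}(a\otimes b)=a\cdot_{p,q}b$, such that $(a\cdot_{p,q}b)\cdot_{pq,t}c=a\cdot_{p,qt}(b\cdot_{q,t}c)$ for all $p,q,t\in\pi$, $a\in A_p,b\in A_q,c\in A_t$. A Rota-Baxter T-algebra of weight $\lambda$, denoted $(A,R)$,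 is a T-algebra $A$ with a family of linear maps $R=\{R_\varphi:A_\varphi\to A_\varphi\}_{\varphi\in\pi}$ such that $R_p(a)\cdot_{p,q}R_q(b)=R_{pq}\big(R_p(a)\cdot_{p,q}b+a\cdot_{p,q}R_q(b)+\lambda\, a\cdot_{p,q}b\big)$ for all $p,q\in\pi$, $a\in A_p$, $b\in A_q$. Write $\mathcal{A}[\pi]=\mathcal{A}\otimes K\pi$, $\mathcal{A}\varphi=\mathcal{A}\otimes K\varphi$ and $h\varphi=h\otimes\varphi$ for $\varphi\in\pi$, $h\in\mathcal{A}$; $\mathcal{A}[\pi]$ is regarded as the T-algebra with components $\{\mathcal{A}\varphi\}_{\varphi\in\pi}$ and multiplications $\mu_{p,q}:\mathcal{A}p\otimes\mathcal{A}q\to\mathcal{A}(pq)$, $(hp)\cdot_{p,q}(gq)=(hg)(pq)$. *)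

theory Defs
  imports "HOL-Algebra.AbelCoset" "HOL-Algebra.Module"
begin

section \<open>Linear maps and tensor products\<close>

text \<open>
  A vector space over the field \<open>K\<close> is a \<^term>\<open>module K V\<close>.  The fields
  \<^const>\<open>mult\<close> and \<^const>\<open>one\<close> of a module record are irrelevant to
  the vector space structure; they are left unspecified below.
\<close>

definition linear_maps ::
  "('k, 'm) ring_scheme \<Rightarrow> ('k, 'v, 'x) module_scheme \<Rightarrow> ('k, 'w, 'y) module_scheme \<Rightarrow> ('v \<Rightarrow> 'w) set"
  where "linear_maps K V W =
    {f \<in> carrier V \<rightarrow> carrier W.
       (\<forall>x\<in>carrier V. \<forall>y\<in>carrier V. f (x \<oplus>\<^bsub>V\<^esub> y) = f x \<oplus>\<^bsub>W\<^esub> f y) \<and>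
       (\<forall>c\<in>carrier K. \<forall>x\<in>carrier V. f (c \<odot>\<^bsub>V\<^esub> x) = c \<odot>\<^bsub>W\<^esub> f x)}"

text \<open>
  The vector space \<open>KS\<close> with basis \<open>S\<close>, as finitely supported functions.  For
  \<open>\<phi> \<in> \<pi>\<close> the line \<open>K\<phi>\<close> inside \<open>K\<pi>\<close> is literally \<open>free_space K {\<phi>}\<close>.
\<close>

definition free_space :: "('k, 'm) ring_scheme \<Rightarrow> 's set \<Rightarrow> ('k, 's \<Rightarrow> 'k) module"
  where "free_space K S =
    \<lparr>carrier = {f. (\<forall>s. f s \<in> carrier K) \<and> finite {s. f s \<noteq> \<zero>\<^bsub>K\<^esub>} \<and> {s. f s \<noteq> \<zero>\<^bsub>K\<^esub>} \<subseteq> S},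
     mult = undefined, one = undefined,
     zero = (\<lambda>s. \<zero>\<^bsub>K\<^esub>), add = (\<lambda>f g s. f s \<oplus>\<^bsub>K\<^esub> g s),
     smult = (\<lambda>c f s. c \<otimes>\<^bsub>K\<^esub> f s)\<rparr>"

definition basis_vec :: "('k, 'm) ring_scheme \<Rightarrow> 's \<Rightarrow> 's \<Rightarrow> 'k"
  where "basis_vec K s = (\<lambda>t. if t = s then \<one>\<^bsub>K\<^esub> else \<zero>\<^bsub>K\<^esub>)"

definition submodule_span ::
  "('k, 'm) ring_scheme \<Rightarrow> ('k, 'v, 'x) module_scheme \<Rightarrow> 'v set \<Rightarrow> 'v set"
  where "submodule_span K V G = \<Inter>{N. submodule N K V \<and> G \<subseteq> N}"

text \<open>
  In the scalar multiplication the coset of \<open>N\<close> is taken again because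
  \<open>{c \<odot> x | x. x \<in> X}\<close> is not a full coset when \<open>c = \<zero>\<close>.
\<close>

definition quotient_module ::
  "('k, 'm) ring_scheme \<Rightarrow> ('k, 'v, 'x) module_scheme \<Rightarrow> 'v set \<Rightarrow> ('k, 'v set) module"
  where "quotient_module K V N =
    \<lparr>carrier = a_rcosets\<^bsub>V\<^esub> N,
     mult = undefined, one = undefined,
     zero = N, add = set_add V,
     smult = (\<lambda>c X. \<Union>x\<in>X. N +>\<^bsub>V\<^esub> (c \<odot>\<^bsub>V\<^esub> x))\<rparr>"

definition tensor_relations ::
  "('k, 'm) ring_scheme \<Rightarrow> ('k, 'v, 'x) module_scheme \<Rightarrow> ('k, 'w, 'y) module_scheme
    \<Rightarrow> ('v \<times> 'w \<Rightarrow> 'k) set"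
  where "tensor_relations K V W =
    (let F = free_space K (carrier V \<times> carrier W); e = (\<lambda>v w. basis_vec K (v, w)) in
      {e (v \<oplus>\<^bsub>V\<^esub> v') w \<ominus>\<^bsub>F\<^esub> (e v w \<oplus>\<^bsub>F\<^esub> e v' w) | v v' w.
          v \<in> carrier V \<and> v' \<in> carrier V \<and> w \<in> carrier W} \<union>
      {e v (w \<oplus>\<^bsub>W\<^esub> w') \<ominus>\<^bsub>F\<^esub> (e v w \<oplus>\<^bsub>F\<^esub> e v w') | v w w'.
          v \<in> carrier V \<and> w \<in> carrier W \<and> w' \<in> carrier W} \<union>
      {e (c \<odot>\<^bsub>V\<^esub> v) w \<ominus>\<^bsub>F\<^esub> c \<odot>\<^bsub>F\<^esub> e v w | c v w.
          c \<in> carrier K \<and> v \<in> carrier V \<and> w \<in> carrier W} \<union>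
      {e v (c \<odot>\<^bsub>W\<^esub> w) \<ominus>\<^bsub>F\<^esub> c \<odot>\<^bsub>F\<^esub> e v w | c v w.
          c \<in> carrier K \<and> v \<in> carrier V \<and> w \<in> carrier W})"

definition tensor_null ::
  "('k, 'm) ring_scheme \<Rightarrow> ('k, 'v, 'x) module_scheme \<Rightarrow> ('k, 'w, 'y) module_scheme
    \<Rightarrow> ('v \<times> 'w \<Rightarrow> 'k) set"
  where "tensor_null K V W =
    submodule_span K (free_space K (carrier V \<times> carrier W)) (tensor_relations K V W)"

definition tensor_space ::
  "('k, 'm) ring_scheme \<Rightarrow> ('k, 'v, 'x) module_scheme \<Rightarrow> ('k, 'w, 'y) module_scheme
    \<Rightarrow> ('k, ('v \<times> 'w \<Rightarrow> 'k) set) module"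
  where "tensor_space K V W =
    quotient_module K (free_space K (carrier V \<times> carrier W)) (tensor_null K V W)"

definition elem_tensor ::
  "('k, 'm) ring_scheme \<Rightarrow> ('k, 'v, 'x) module_scheme \<Rightarrow> ('k, 'w, 'y) module_scheme
    \<Rightarrow> 'v \<Rightarrow> 'w \<Rightarrow> ('v \<times> 'w \<Rightarrow> 'k) set"
  where "elem_tensor K V W v w =
    tensor_null K V W +>\<^bsub>free_space K (carrier V \<times> carrier W)\<^esub> basis_vec K (v, w)"

section \<open>Rota-Baxter algebras\<close>

text \<open>
  Associative, not necessarily unital or commutative; the field \<^const>\<open>one\<close> of
  the record is ignored.  (The locale \<^locale>\<open>algebra\<close> of the library is
  unital and commutative.)
\<close>

locale assoc_algebra = K?: field K + module K A
  for K (structure) and A (structure) +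
  assumes mult_closed: "\<lbrakk>a \<in> carrier A; b \<in> carrier A\<rbrakk> \<Longrightarrow> a \<otimes>\<^bsub>A\<^esub> b \<in> carrier A"
    and mult_assoc: "\<lbrakk>a \<in> carrier A; b \<in> carrier A; c \<in> carrier A\<rbrakk>
      \<Longrightarrow> (a \<otimes>\<^bsub>A\<^esub> b) \<otimes>\<^bsub>A\<^esub> c = a \<otimes>\<^bsub>A\<^esub> (b \<otimes>\<^bsub>A\<^esub> c)"
    and mult_add_left: "\<lbrakk>a \<in> carrier A; b \<in> carrier A; c \<in> carrier A\<rbrakk>
      \<Longrightarrow> (a \<oplus>\<^bsub>A\<^esub> b) \<otimes>\<^bsub>A\<^esub> c = a \<otimes>\<^bsub>A\<^esub> c \<oplus>\<^bsub>A\<^esub> b \<otimes>\<^bsub>A\<^esub> c"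
    and mult_add_right: "\<lbrakk>a \<in> carrier A; b \<in> carrier A; c \<in> carrier A\<rbrakk>
      \<Longrightarrow> a \<otimes>\<^bsub>A\<^esub> (b \<oplus>\<^bsub>A\<^esub> c) = a \<otimes>\<^bsub>A\<^esub> b \<oplus>\<^bsub>A\<^esub> a \<otimes>\<^bsub>A\<^esub> c"
    and mult_smult_left: "\<lbrakk>k \<in> carrier K; a \<in> carrier A; b \<in> carrier A\<rbrakk>
      \<Longrightarrow> (k \<odot>\<^bsub>A\<^esub> a) \<otimes>\<^bsub>A\<^esub> b = k \<odot>\<^bsub>A\<^esub> (a \<otimes>\<^bsub>A\<^esub> b)"
    and mult_smult_right: "\<lbrakk>k \<in> carrier K; a \<in> carrier A; b \<in> carrier A\<rbrakk>
      \<Longrightarrow> a \<otimes>\<^bsub>A\<^esub> (k \<odot>\<^bsub>A\<^esub> b) = k \<odot>\<^bsub>A\<^esub> (a \<otimes>\<^bsub>A\<^esub> b)"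

locale rota_baxter_algebra = assoc_algebra K A
  for K (structure) and A (structure) and l and R +
  assumes weight_closed: "l \<in> carrier K"
    and R_linear: "R \<in> linear_maps K A A"
    and rota_baxter: "\<lbrakk>a \<in> carrier A; b \<in> carrier A\<rbrakk>
      \<Longrightarrow> R a \<otimes>\<^bsub>A\<^esub> R b = R (a \<otimes>\<^bsub>A\<^esub> R b) \<oplus>\<^bsub>A\<^esub> R (R a \<otimes>\<^bsub>A\<^esub> b) \<oplus>\<^bsub>A\<^esub> l \<odot>\<^bsub>A\<^esub> R (a \<otimes>\<^bsub>A\<^esub> b)"

section \<open>Rota-Baxter T-algebras\<close>

text \<open>A nonempty semigroup; the field \<^const>\<open>one\<close> of the record is ignored.\<close>

locale nonempty_semigroup =
  fixes P (structure)
  assumes semi_closed: "\<lbrakk>p \<in> carrier P; q \<in> carrier P\<rbrakk> \<Longrightarrow> p \<otimes>\<^bsub>P\<^esub> q \<in> carrier P"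
    and semi_assoc: "\<lbrakk>p \<in> carrier P; q \<in> carrier P; t \<in> carrier P\<rbrakk>
      \<Longrightarrow> (p \<otimes>\<^bsub>P\<^esub> q) \<otimes>\<^bsub>P\<^esub> t = p \<otimes>\<^bsub>P\<^esub> (q \<otimes>\<^bsub>P\<^esub> t)"
    and semi_nonempty: "carrier P \<noteq> {}"

text \<open>The product \<open>a \<cdot>\<^sub>p\<^sub>,\<^sub>q b = \<mu>\<^sub>p\<^sub>,\<^sub>q (a \<otimes> b)\<close> of a family \<open>A\<close> with multiplications \<open>\<mu>\<close>.\<close>

definition T_prod ::
  "('k, 'm) ring_scheme \<Rightarrow> ('p \<Rightarrow> ('k, 'v, 'x) module_scheme)
    \<Rightarrow> ('p \<Rightarrow> 'p \<Rightarrow> ('v \<times> 'v \<Rightarrow> 'k) set \<Rightarrow> 'v) \<Rightarrow> 'p \<Rightarrow> 'p \<Rightarrow> 'v \<Rightarrow> 'v \<Rightarrow> 'v"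
  where "T_prod K A \<mu> p q a b = \<mu> p q (elem_tensor K (A p) (A q) a b)"

locale T_algebra = K?: field K + P?: nonempty_semigroup P
  for K :: "('k, 'm) ring_scheme" (structure) and P :: "('p, 'n) monoid_scheme" (structure)
    and A :: "'p \<Rightarrow> ('k, 'v, 'x) module_scheme"
    and \<mu> :: "'p \<Rightarrow> 'p \<Rightarrow> ('v \<times> 'v \<Rightarrow> 'k) set \<Rightarrow> 'v" +
  assumes comp_module: "p \<in> carrier P \<Longrightarrow> module K (A p)"
    and mu_linear: "\<lbrakk>p \<in> carrier P; q \<in> carrier P\<rbrakk>
      \<Longrightarrow> \<mu> p q \<in> linear_maps K (tensor_space K (A p) (A q)) (A (p \<otimes>\<^bsub>P\<^esub> q))"
    and T_assoc: "\<lbrakk>p \<in> carrier P; q \<in> carrier P; t \<in> carrier P;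
        a \<in> carrier (A p); b \<in> carrier (A q); c \<in> carrier (A t)\<rbrakk>
      \<Longrightarrow> T_prod K A \<mu> (p \<otimes>\<^bsub>P\<^esub> q) t (T_prod K A \<mu> p q a b) c
        = T_prod K A \<mu> p (q \<otimes>\<^bsub>P\<^esub> t) a (T_prod K A \<mu> q t b c)"

locale rota_baxter_T_algebra = T_algebra K P A \<mu>
  for K :: "('k, 'm) ring_scheme" (structure) and P :: "('p, 'n) monoid_scheme" (structure)
    and A :: "'p \<Rightarrow> ('k, 'v, 'x) module_scheme"
    and \<mu> :: "'p \<Rightarrow> 'p \<Rightarrow> ('v \<times> 'v \<Rightarrow> 'k) set \<Rightarrow> 'v"
    and l :: 'k and R :: "'p \<Rightarrow> 'v \<Rightarrow> 'v" +
  assumes weight_closed: "l \<in> carrier K"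
    and R_linear: "p \<in> carrier P \<Longrightarrow> R p \<in> linear_maps K (A p) (A p)"
    and rota_baxter: "\<lbrakk>p \<in> carrier P; q \<in> carrier P; a \<in> carrier (A p); b \<in> carrier (A q)\<rbrakk>
      \<Longrightarrow> T_prod K A \<mu> p q (R p a) (R q b)
        = R (p \<otimes>\<^bsub>P\<^esub> q)
            (T_prod K A \<mu> p q (R p a) b \<oplus>\<^bsub>A (p \<otimes>\<^bsub>P\<^esub> q)\<^esub> T_prod K A \<mu> p q a (R q b)
              \<oplus>\<^bsub>A (p \<otimes>\<^bsub>P\<^esub> q)\<^esub> l \<odot>\<^bsub>A (p \<otimes>\<^bsub>P\<^esub> q)\<^esub> T_prod K A \<mu> p q a b)"

section \<open>The T-algebra \<open>A[\<pi>]\<close>\<close>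

text \<open>The component \<open>A\<phi> = A \<otimes> K\<phi>\<close> and its elements \<open>h\<phi> = h \<otimes> \<phi>\<close>.\<close>

definition comp_space ::
  "('k, 'm) ring_scheme \<Rightarrow> ('k, 'a, 'x) module_scheme \<Rightarrow> 'p
    \<Rightarrow> ('k, ('a \<times> ('p \<Rightarrow> 'k) \<Rightarrow> 'k) set) module"
  where "comp_space K A \<phi> = tensor_space K A (free_space K {\<phi>})"

definition comp_elem ::
  "('k, 'm) ring_scheme \<Rightarrow> ('k, 'a, 'x) module_scheme \<Rightarrow> 'a \<Rightarrow> 'p
    \<Rightarrow> ('a \<times> ('p \<Rightarrow> 'k) \<Rightarrow> 'k) set"
  where "comp_elem K A h \<phi> = elem_tensor K A (free_space K {\<phi>}) h (basis_vec K \<phi>)"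

text \<open>
  The multiplication \<open>Ap \<otimes> Aq \<rightarrow> A(pq)\<close> is the unique linear map with
  \<open>hp \<otimes> gq \<mapsto> (hg)(pq)\<close>, and \<open>R\<^sub>\<phi>\<close> the unique linear map with \<open>h\<phi> \<mapsto> R(h)\<phi>\<close>.
  Requiring extensionality makes them unique as HOL functions.
\<close>

definition comp_mult ::
  "('k, 'm) ring_scheme \<Rightarrow> ('p, 'n) monoid_scheme \<Rightarrow> ('k, 'a, 'x) module_scheme \<Rightarrow> 'p \<Rightarrow> 'p
    \<Rightarrow> (('a \<times> ('p \<Rightarrow> 'k) \<Rightarrow> 'k) set \<times> ('a \<times> ('p \<Rightarrow> 'k) \<Rightarrow> 'k) set \<Rightarrow> 'k) set
    \<Rightarrow> ('a \<times> ('p \<Rightarrow> 'k) \<Rightarrow> 'k) set"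
  where "comp_mult K P A p q =
    (THE m. m \<in> linear_maps K (tensor_space K (comp_space K A p) (comp_space K A q))
                  (comp_space K A (p \<otimes>\<^bsub>P\<^esub> q)) \<and>
       m \<in> extensional (carrier (tensor_space K (comp_space K A p) (comp_space K A q))) \<and>
       (\<forall>h\<in>carrier A. \<forall>g\<in>carrier A.
          m (elem_tensor K (comp_space K A p) (comp_space K A q) (comp_elem K A h p) (comp_elem K A g q))
            = comp_elem K A (h \<otimes>\<^bsub>A\<^esub> g) (p \<otimes>\<^bsub>P\<^esub> q)))"

definition comp_op ::
  "('k, 'm) ring_scheme \<Rightarrow> ('k, 'a, 'x) module_scheme \<Rightarrow> ('a \<Rightarrow> 'a) \<Rightarrow> 'p
    \<Rightarrow> ('a \<times> ('p \<Rightarrow> 'k) \<Rightarrow> 'k) set \<Rightarrow> ('a \<times> ('p \<Rightarrow> 'k) \<Rightarrow> 'k) set"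
  where "comp_op K A R \<phi> =
    (THE r. r \<in> linear_maps K (comp_space K A \<phi>) (comp_space K A \<phi>) \<and>
       r \<in> extensional (carrier (comp_space K A \<phi>)) \<and>
       (\<forall>h\<in>carrier A. r (comp_elem K A h \<phi>) = comp_elem K A (R h) \<phi>))"

end

theory Submission
  imports Defs
begin

text \<open>
  Since \<open>K\<phi>\<close> is a line, \<open>h \<mapsto> h\<phi>\<close> is a linear isomorphism from \<open>A\<close> onto \<open>A\<phi>\<close>.  Through these
  isomorphisms the Rota-Baxter identity of \<open>A[\<pi>]\<close> for \<open>ap\<close> and \<open>bq\<close> is the \<open>pq\<close>-component of the
  identity of \<open>A\<close> for \<open>a\<close> and \<open>b\<close>; any one pair \<open>p, q\<close> recovers the latter.  The definite
  descriptions of \<open>\<mu>\<^sub>p\<^sub>,\<^sub>q\<close> and \<open>R\<^sub>\<phi>\<close> are resolved with the universal property of the tensor product.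
\<close>

section \<open>Linear maps\<close>

lemma linear_mapsI:
  assumes "\<And>x. x \<in> carrier V \<Longrightarrow> f x \<in> carrier W"
    and "\<And>x y. \<lbrakk>x \<in> carrier V; y \<in> carrier V\<rbrakk> \<Longrightarrow> f (x \<oplus>\<^bsub>V\<^esub> y) = f x \<oplus>\<^bsub>W\<^esub> f y"
    and "\<And>c x. \<lbrakk>c \<in> carrier K; x \<in> carrier V\<rbrakk> \<Longrightarrow> f (c \<odot>\<^bsub>V\<^esub> x) = c \<odot>\<^bsub>W\<^esub> f x"
  shows "f \<in> linear_maps K V W"
  using assms by (auto simp: linear_maps_def)

lemma linear_mapsD:
  assumes "f \<in> linear_maps K V W"
  shows "x \<in> carrier V \<Longrightarrow> f x \<in> carrier W"
    and "\<lbrakk>x \<in> carrier V; y \<in> carrier V\<rbrakk> \<Longrightarrow> f (x \<oplus>\<^bsub>V\<^esub> y) = f x \<oplus>\<^bsub>W\<^esub> f y"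
    and "\<lbrakk>c \<in> carrier K; x \<in> carrier V\<rbrakk> \<Longrightarrow> f (c \<odot>\<^bsub>V\<^esub> x) = c \<odot>\<^bsub>W\<^esub> f x"
  using assms by (auto simp: linear_maps_def)

text \<open>\<open>linear_maps\<close> demands only additivity and homogeneity. The values at zero
  and, in the next lemma, at negatives come from homogeneity with the scalars 0 and -1.\<close>

lemma linear_maps_zero:
  assumes "module K V" "module K W" "f \<in> linear_maps K V W"
  shows "f \<zero>\<^bsub>V\<^esub> = \<zero>\<^bsub>W\<^esub>"
proof -
  interpret V: module K V by fact
  interpret W: module K W by fact
  have "f (\<zero>\<^bsub>K\<^esub> \<odot>\<^bsub>V\<^esub> \<zero>\<^bsub>V\<^esub>) = \<zero>\<^bsub>K\<^esub> \<odot>\<^bsub>W\<^esub> f \<zero>\<^bsub>V\<^esub>"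
    by (rule linear_mapsD(3)[OF assms(3)]) simp_all
  then show ?thesis
    using linear_mapsD(1)[OF assms(3)] by simp
qed

lemma linear_maps_uminus:
  assumes "module K V" "module K W" "f \<in> linear_maps K V W" "x \<in> carrier V"
  shows "f (\<ominus>\<^bsub>V\<^esub> x) = \<ominus>\<^bsub>W\<^esub> f x"
proof -
  interpret V: module K V by fact
  interpret W: module K W by fact
  have "f ((\<ominus>\<^bsub>K\<^esub> \<one>\<^bsub>K\<^esub>) \<odot>\<^bsub>V\<^esub> x) = (\<ominus>\<^bsub>K\<^esub> \<one>\<^bsub>K\<^esub>) \<odot>\<^bsub>W\<^esub> f x"
    using assms(4) by (intro linear_mapsD(3)[OF assms(3)]) simp_all
  then show ?thesis
    using linear_mapsD(1)[OF assms(3)] assms(4) by (simp add: V.smult_l_minus W.smult_l_minus)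
qed

lemma linear_maps_minus:
  assumes "module K V" "module K W" "f \<in> linear_maps K V W" "x \<in> carrier V" "y \<in> carrier V"
  shows "f (x \<ominus>\<^bsub>V\<^esub> y) = f x \<ominus>\<^bsub>W\<^esub> f y"
proof -
  interpret V: module K V by fact
  show ?thesis
    using assms by (simp add: a_minus_def linear_mapsD(2)[OF assms(3)] linear_maps_uminus)
qed

lemma linear_maps_comp:
  assumes "f \<in> linear_maps K V W" "g \<in> linear_maps K W U"
  shows "(\<lambda>x. g (f x)) \<in> linear_maps K V U"
  by (rule linear_mapsI) (simp_all add: linear_mapsD[OF assms(1)] linear_mapsD[OF assms(2)])

text \<open>Prepares the extensional witnesses that the definite descriptions
  \<open>comp_mult\<close> and \<open>comp_op\<close> ask for. The restriction stays linear because
  sums and multiples of vectors of V remain in its carrier.\<close>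

lemma linear_maps_restrict:
  assumes "module K V" "f \<in> linear_maps K V W"
  shows "restrict f (carrier V) \<in> linear_maps K V W"
proof -
  interpret V: module K V by fact
  show ?thesis
    by (rule linear_mapsI) (simp_all add: linear_mapsD[OF assms(2)])
qed

section \<open>The free vector space\<close>

lemma free_space_simps:
  "\<zero>\<^bsub>free_space K S\<^esub> = (\<lambda>s. \<zero>\<^bsub>K\<^esub>)"
  "f \<oplus>\<^bsub>free_space K S\<^esub> g = (\<lambda>s. f s \<oplus>\<^bsub>K\<^esub> g s)"
  "c \<odot>\<^bsub>free_space K S\<^esub> f = (\<lambda>s. c \<otimes>\<^bsub>K\<^esub> f s)"
  by (simp_all add: free_space_def)

lemma free_space_carrier:
  "f \<in> carrier (free_space K S) \<longleftrightarrow>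
    (\<forall>s. f s \<in> carrier K) \<and> finite {s. f s \<noteq> \<zero>\<^bsub>K\<^esub>} \<and> {s. f s \<noteq> \<zero>\<^bsub>K\<^esub>} \<subseteq> S"
  by (simp add: free_space_def)

lemma basis_vec_carrier:
  assumes "cring K" "s \<in> S"
  shows "basis_vec K s \<in> carrier (free_space K S)"
proof -
  interpret K: cring K by fact
  have "{t. basis_vec K s t \<noteq> \<zero>\<^bsub>K\<^esub>} \<subseteq> {s}"
    by (auto simp: basis_vec_def)
  then show ?thesis
    using assms(2) finite_subset[of _ "{s}"] by (auto simp: free_space_carrier basis_vec_def)
qed

lemma free_space_module:
  assumes "cring K"
  shows "module K (free_space K S)"
proof -
  interpret K: cring K by fact
  let ?F = "free_space K S"
  \<comment> \<open>A function vanishing wherever f and g both vanish has its support inside the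
    union of their supports. Sums, negatives and scalar multiples are all instances.\<close>
  have support: "finite {s. h s \<noteq> \<zero>\<^bsub>K\<^esub>} \<and> {s. h s \<noteq> \<zero>\<^bsub>K\<^esub>} \<subseteq> S"
    if "f \<in> carrier ?F" "g \<in> carrier ?F" "\<And>s. f s = \<zero>\<^bsub>K\<^esub> \<Longrightarrow> g s = \<zero>\<^bsub>K\<^esub> \<Longrightarrow> h s = \<zero>\<^bsub>K\<^esub>"
    for f g h
  proof -
    have "{s. h s \<noteq> \<zero>\<^bsub>K\<^esub>} \<subseteq> {s. f s \<noteq> \<zero>\<^bsub>K\<^esub>} \<union> {s. g s \<noteq> \<zero>\<^bsub>K\<^esub>}"
      using that(3) by auto
    moreover have "finite ({s. f s \<noteq> \<zero>\<^bsub>K\<^esub>} \<union> {s. g s \<noteq> \<zero>\<^bsub>K\<^esub>})"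
      "{s. f s \<noteq> \<zero>\<^bsub>K\<^esub>} \<union> {s. g s \<noteq> \<zero>\<^bsub>K\<^esub>} \<subseteq> S"
      using that(1,2) by (simp_all add: free_space_carrier)
    ultimately show ?thesis
      using finite_subset by blast
  qed
  have [simp]: "f s \<in> carrier K" if "f \<in> carrier ?F" for f s
    using that by (simp add: free_space_carrier)
  show ?thesis
  proof (rule moduleI)
    show "abelian_group ?F"
    proof (rule abelian_groupI)
      fix f g assume "f \<in> carrier ?F" "g \<in> carrier ?F"
      then show "f \<oplus>\<^bsub>?F\<^esub> g \<in> carrier ?F"
        using support[of f g "\<lambda>s. f s \<oplus>\<^bsub>K\<^esub> g s"]
        by (subst free_space_carrier) (simp add: free_space_simps)
    next
      fix f assume f: "f \<in> carrier ?F"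
      then have "(\<lambda>s. \<ominus>\<^bsub>K\<^esub> f s) \<in> carrier ?F"
        using support[of f f "\<lambda>s. \<ominus>\<^bsub>K\<^esub> f s"] by (subst free_space_carrier) simp
      moreover have "(\<lambda>s. \<ominus>\<^bsub>K\<^esub> f s) \<oplus>\<^bsub>?F\<^esub> f = \<zero>\<^bsub>?F\<^esub>"
        using f by (simp add: free_space_simps K.l_neg)
      ultimately show "\<exists>g\<in>carrier ?F. g \<oplus>\<^bsub>?F\<^esub> f = \<zero>\<^bsub>?F\<^esub>"
        by blast
    qed (simp_all add: free_space_simps K.a_ac, simp add: free_space_carrier)
  next
    fix c f assume "c \<in> carrier K" "f \<in> carrier ?F"
    then show "c \<odot>\<^bsub>?F\<^esub> f \<in> carrier ?F"
      using support[of f f "\<lambda>s. c \<otimes>\<^bsub>K\<^esub> f s"]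
      by (subst free_space_carrier) (simp add: free_space_simps)
  qed (simp_all add: free_space_simps K.l_distr K.r_distr K.m_assoc assms)
qed

text \<open>The linear extension to the free space of a map f given on its basis. Summing over the
  support of g keeps the sum finite.\<close>

definition free_lift ::
  "('k, 'm) ring_scheme \<Rightarrow> ('k, 'w, 'y) module_scheme \<Rightarrow> ('s \<Rightarrow> 'w) \<Rightarrow> ('s \<Rightarrow> 'k) \<Rightarrow> 'w"
  where "free_lift K W f g = (\<Oplus>\<^bsub>W\<^esub>s\<in>{s. g s \<noteq> \<zero>\<^bsub>K\<^esub>}. g s \<odot>\<^bsub>W\<^esub> f s)"

text \<open>Indices outside the support contribute zero terms. This allows the sums for several
  functions to be taken over one common index set.\<close>

lemma free_lift_superset:
  assumes "module K W" "f \<in> S \<rightarrow> carrier W" "g \<in> carrier (free_space K S)"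
    and "finite T" "{s. g s \<noteq> \<zero>\<^bsub>K\<^esub>} \<subseteq> T" "T \<subseteq> S"
  shows "free_lift K W f g = (\<Oplus>\<^bsub>W\<^esub>s\<in>T. g s \<odot>\<^bsub>W\<^esub> f s)"
proof -
  interpret W: module K W by fact
  have "f s \<in> carrier W" if "s \<in> T" for s
    using that assms(2,6) by auto
  then show ?thesis
    unfolding free_lift_def
    by (intro W.M.add.finprod_mono_neutral_cong_left)
      (use assms in \<open>auto simp: free_space_carrier\<close>)
qed

lemma free_lift_linear:
  assumes "module K W" "f \<in> S \<rightarrow> carrier W"
  shows "free_lift K W f \<in> linear_maps K (free_space K S) W"
proof -
  interpret W: module K W by fact
  interpret F: module K "free_space K S"
    by (rule free_space_module) (rule W.R.is_cring)
  note sup = free_lift_superset[OF assms]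
  show ?thesis
  proof (rule linear_mapsI)
    fix g assume "g \<in> carrier (free_space K S)"
    then show "free_lift K W f g \<in> carrier W"
      using assms(2) unfolding free_lift_def free_space_carrier
      by (intro W.M.finsum_closed) auto
  next
    fix g h assume gh: "g \<in> carrier (free_space K S)" "h \<in> carrier (free_space K S)"
    \<comment> \<open>Cancellation can make the support of the sum smaller than this union, so all
      three sums are compared over the union.\<close>
    let ?T = "{s. g s \<noteq> \<zero>\<^bsub>K\<^esub>} \<union> {s. h s \<noteq> \<zero>\<^bsub>K\<^esub>}"
    have T: "finite ?T" "?T \<subseteq> S"
      using gh by (simp_all add: free_space_carrier)
    have "free_lift K W f (g \<oplus>\<^bsub>free_space K S\<^esub> h)
        = (\<Oplus>\<^bsub>W\<^esub>s\<in>?T. (g \<oplus>\<^bsub>free_space K S\<^esub> h) s \<odot>\<^bsub>W\<^esub> f s)"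
      using gh T F.M.a_closed[OF gh] by (intro sup) (auto simp: free_space_simps)
    also have "\<dots> = (\<Oplus>\<^bsub>W\<^esub>s\<in>?T. g s \<odot>\<^bsub>W\<^esub> f s \<oplus>\<^bsub>W\<^esub> h s \<odot>\<^bsub>W\<^esub> f s)"
      using gh T assms(2)
      by (intro W.M.finsum_cong') (auto simp: free_space_simps free_space_carrier Pi_iff
          subset_iff intro!: W.smult_l_distr)
    also have "\<dots> = (\<Oplus>\<^bsub>W\<^esub>s\<in>?T. g s \<odot>\<^bsub>W\<^esub> f s) \<oplus>\<^bsub>W\<^esub> (\<Oplus>\<^bsub>W\<^esub>s\<in>?T. h s \<odot>\<^bsub>W\<^esub> f s)"
      using gh T assms(2) by (intro W.M.finsum_addf) (auto simp: free_space_carrier Pi_iff subset_iff)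
    also have "\<dots> = free_lift K W f g \<oplus>\<^bsub>W\<^esub> free_lift K W f h"
      using gh T by (simp add: sup[of g ?T] sup[of h ?T])
    finally show "free_lift K W f (g \<oplus>\<^bsub>free_space K S\<^esub> h)
        = free_lift K W f g \<oplus>\<^bsub>W\<^esub> free_lift K W f h" .
  next
    fix c g assume cg: "c \<in> carrier K" "g \<in> carrier (free_space K S)"
    \<comment> \<open>The support of the multiple may shrink, for instance when c is zero, so both
      sums run over the support of g.\<close>
    let ?T = "{s. g s \<noteq> \<zero>\<^bsub>K\<^esub>}"
    have T: "finite ?T" "?T \<subseteq> S"
      using cg by (simp_all add: free_space_carrier)
    have "free_lift K W f (c \<odot>\<^bsub>free_space K S\<^esub> g)
        = (\<Oplus>\<^bsub>W\<^esub>s\<in>?T. (c \<odot>\<^bsub>free_space K S\<^esub> g) s \<odot>\<^bsub>W\<^esub> f s)"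
      using cg T F.smult_closed[OF cg] by (intro sup) (auto simp: free_space_simps)
    also have "\<dots> = (\<Oplus>\<^bsub>W\<^esub>s\<in>?T. c \<odot>\<^bsub>W\<^esub> (g s \<odot>\<^bsub>W\<^esub> f s))"
      using cg T assms(2)
      by (intro W.M.finsum_cong') (auto simp: free_space_simps free_space_carrier Pi_iff
          subset_iff intro!: W.smult_assoc1)
    also have "\<dots> = c \<odot>\<^bsub>W\<^esub> free_lift K W f g"
      using cg T assms(2) unfolding free_lift_def
      by (intro W.finsum_smult_ldistr[symmetric]) (auto simp: free_space_carrier)
    finally show "free_lift K W f (c \<odot>\<^bsub>free_space K S\<^esub> g) = c \<odot>\<^bsub>W\<^esub> free_lift K W f g" .
  qed
qed

lemma free_lift_basis_vec:
  assumes "module K W" "f \<in> S \<rightarrow> carrier W" "s \<in> S"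
  shows "free_lift K W f (basis_vec K s) = f s"
proof -
  interpret W: module K W by fact
  have fs: "f s \<in> carrier W"
    using assms(2,3) by auto
  have "free_lift K W f (basis_vec K s) = (\<Oplus>\<^bsub>W\<^esub>t\<in>{s}. basis_vec K s t \<odot>\<^bsub>W\<^esub> f t)"
    using assms basis_vec_carrier[OF W.R.is_cring assms(3)]
    by (intro free_lift_superset[OF assms(1,2)]) (auto simp: basis_vec_def)
  also have "\<dots> = f s"
    using fs by (subst W.M.finsum_insert) (auto simp: basis_vec_def)
  finally show ?thesis .
qed

text \<open>The basis vectors span the free space: induction on the finite support of x splits off
  one coordinate at a time.\<close>

lemma free_space_linear_eqI:
  assumes K: "cring K" and W: "module K W"
    and f: "f \<in> linear_maps K (free_space K S) W"
    and g: "g \<in> linear_maps K (free_space K S) W"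
    and eq: "\<And>s. s \<in> S \<Longrightarrow> f (basis_vec K s) = g (basis_vec K s)"
    and x: "x \<in> carrier (free_space K S)"
  shows "f x = g x"
proof -
  let ?F = "free_space K S"
  interpret K: cring K by fact
  interpret F: module K ?F by (rule free_space_module) (rule K)
  have "finite {s. x s \<noteq> \<zero>\<^bsub>K\<^esub>}"
    using x by (simp add: free_space_carrier)
  then show ?thesis
    using x
  proof (induction "{s. x s \<noteq> \<zero>\<^bsub>K\<^esub>}" arbitrary: x rule: finite_induct)
    case empty
    then have "x = \<zero>\<^bsub>?F\<^esub>"
      by (auto simp: free_space_simps)
    then show ?case
      using linear_maps_zero[OF F.module_axioms W f] linear_maps_zero[OF F.module_axioms W g] by simp
  next
    case (insert s T)
    \<comment> \<open>Erasing the coordinate at s leaves a vector with support T, to which the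
      induction hypothesis applies.\<close>
    define y where "y = x(s := \<zero>\<^bsub>K\<^esub>)"
    have s: "s \<in> S" and xs: "\<And>t. x t \<in> carrier K"
      using insert.prems insert.hyps(4) by (auto simp: free_space_carrier)
    have T: "T = {s. y s \<noteq> \<zero>\<^bsub>K\<^esub>}"
      using insert.hyps(2,4) by (auto simp: y_def)
    have y: "y \<in> carrier ?F"
      using insert.prems insert.hyps(1) T by (auto simp: free_space_carrier y_def)
    have b: "basis_vec K s \<in> carrier ?F"
      using K s by (rule basis_vec_carrier)
    have xy: "x = x s \<odot>\<^bsub>?F\<^esub> basis_vec K s \<oplus>\<^bsub>?F\<^esub> y"
      using xs by (auto simp: free_space_simps basis_vec_def y_def)
    have hx: "h x = x s \<odot>\<^bsub>W\<^esub> h (basis_vec K s) \<oplus>\<^bsub>W\<^esub> h y" if "h \<in> linear_maps K ?F W" for h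
      by (subst xy) (simp add: linear_mapsD[OF that] b y xs)
    then show ?case
      using hx[OF f] hx[OF g] eq[OF s] insert.hyps(3)[OF T y] by simp
  qed
qed

section \<open>Submodules and quotients\<close>

text \<open>Opens the way to the library facts on cosets, which are stated for
  \<open>abelian_subgroup\<close>.\<close>

lemma submodule_abelian_subgroup:
  assumes "module K V" "submodule N K V"
  shows "abelian_subgroup N V"
proof -
  interpret V: module K V by fact
  interpret N: submodule N K V by fact
  show ?thesis
    by (rule abelian_subgroupI3) (rule additive_subgroupI N.subgroup_axioms V.M.abelian_group_axioms)+
qed

lemma submodule_span_submodule:
  assumes "module K V" "G \<subseteq> carrier V"
  shows "submodule (submodule_span K V G) K V"
proof -
  interpret V: module K V by fact
  have "\<zero>\<^bsub>V\<^esub> \<in> N" if "submodule N K V" for N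
    using subgroup.one_closed[OF submodule.axioms(1)[OF that]] by simp
  \<comment> \<open>V itself is one of the submodules that are intersected, which keeps the span
    inside the carrier of V.\<close>
  moreover have "submodule (carrier V) K V"
    by (rule V.carrier_is_submodule)
  ultimately show ?thesis
    using assms(2) unfolding submodule_span_def
    by (intro V.submoduleI) (auto intro: V.submoduleE(3-5))
qed

lemma submodule_span_superset: "G \<subseteq> submodule_span K V G"
  by (auto simp: submodule_span_def)

lemma submodule_span_minimal:
  assumes "submodule N K V" "G \<subseteq> N"
  shows "submodule_span K V G \<subseteq> N"
  using assms by (auto simp: submodule_span_def)

text \<open>Combined with the minimality of the span, this reduces showing that f kills a span to
  checking the generators.\<close>

lemma linear_maps_kernel_submodule:
  assumes "module K V" "module K W" "f \<in> linear_maps K V W"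
  shows "submodule {x \<in> carrier V. f x = \<zero>\<^bsub>W\<^esub>} K V"
proof -
  interpret V: module K V by fact
  interpret W: module K W by fact
  show ?thesis
    by (rule V.submoduleI)
      (auto simp: linear_maps_zero[OF assms] linear_maps_uminus[OF assms] linear_mapsD[OF assms(3)])
qed

lemma quotient_module_simps:
  "carrier (quotient_module K V N) = a_rcosets\<^bsub>V\<^esub> N"
  "\<zero>\<^bsub>quotient_module K V N\<^esub> = N"
  "X \<oplus>\<^bsub>quotient_module K V N\<^esub> Y = X <+>\<^bsub>V\<^esub> Y"
  "c \<odot>\<^bsub>quotient_module K V N\<^esub> X = (\<Union>x\<in>X. N +>\<^bsub>V\<^esub> (c \<odot>\<^bsub>V\<^esub> x))"
  by (simp_all add: quotient_module_def)

text \<open>The union in the definition of the scalar multiplication ranges over equal cosets: for y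
  in the coset of x the difference y - x lies in N, hence so does c(y - x), and c y and c x have the
  same coset.\<close>

lemma quotient_module_smult:
  assumes "module K V" "submodule N K V" "c \<in> carrier K" "x \<in> carrier V"
  shows "c \<odot>\<^bsub>quotient_module K V N\<^esub> (N +>\<^bsub>V\<^esub> x) = N +>\<^bsub>V\<^esub> (c \<odot>\<^bsub>V\<^esub> x)"
proof -
  interpret V: module K V by fact
  interpret N: submodule N K V by fact
  interpret S: abelian_subgroup N V
    by (rule submodule_abelian_subgroup) fact+
  have "N +>\<^bsub>V\<^esub> (c \<odot>\<^bsub>V\<^esub> y) = N +>\<^bsub>V\<^esub> (c \<odot>\<^bsub>V\<^esub> x)" if y: "y \<in> N +>\<^bsub>V\<^esub> x" for y
  proof -
    have yV: "y \<in> carrier V"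
      using S.a_elemrcos_carrier assms(4) y by blast
    have "c \<odot>\<^bsub>V\<^esub> (y \<oplus>\<^bsub>V\<^esub> \<ominus>\<^bsub>V\<^esub> x) \<in> N"
      using S.a_rcos_module_imp[OF assms(4) y] assms(3) by (rule N.smult_closed[rotated])
    then have "c \<odot>\<^bsub>V\<^esub> y \<oplus>\<^bsub>V\<^esub> \<ominus>\<^bsub>V\<^esub> (c \<odot>\<^bsub>V\<^esub> x) \<in> N"
      using assms(3,4) yV by (simp add: V.smult_r_distr V.smult_r_minus)
    then have "c \<odot>\<^bsub>V\<^esub> y \<in> N +>\<^bsub>V\<^esub> (c \<odot>\<^bsub>V\<^esub> x)"
      using assms(3,4) yV by (intro S.a_rcos_module_rev) simp_all
    then show ?thesis
      using S.a_repr_independence' assms(3,4) by simp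
  qed
  \<comment> \<open>The coset is nonempty, so the union of a constant family over it is that
    constant.\<close>
  moreover have "x \<in> N +>\<^bsub>V\<^esub> x"
    using assms(4) by (rule S.a_rcos_self)
  ultimately show ?thesis
    unfolding quotient_module_simps by (metis (no_types, lifting) SUP_cong SUP_const empty_iff)
qed

lemma quotient_module_carrierE:
  assumes "X \<in> carrier (quotient_module K V N)"
  obtains x where "x \<in> carrier V" "X = N +>\<^bsub>V\<^esub> x"
  using assms by (auto simp: quotient_module_simps A_RCOSETS_def')

lemma quotient_map_linear:
  assumes "module K V" "submodule N K V"
  shows "(\<lambda>x. N +>\<^bsub>V\<^esub> x) \<in> linear_maps K V (quotient_module K V N)"
proof -
  interpret V: module K V by fact
  interpret S: abelian_subgroup N V
    by (rule submodule_abelian_subgroup) fact+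
  show ?thesis
  proof (rule linear_mapsI)
    fix x assume "x \<in> carrier V"
    then show "N +>\<^bsub>V\<^esub> x \<in> carrier (quotient_module K V N)"
      by (simp add: quotient_module_simps V.M.a_rcosetsI S.a_subset)
  next
    fix c x assume "c \<in> carrier K" "x \<in> carrier V"
    then show "N +>\<^bsub>V\<^esub> (c \<odot>\<^bsub>V\<^esub> x) = c \<odot>\<^bsub>quotient_module K V N\<^esub> (N +>\<^bsub>V\<^esub> x)"
      by (simp add: quotient_module_smult[OF assms])
  qed (simp add: quotient_module_simps S.a_rcos_sum)
qed

text \<open>Every element of the quotient is the coset of a vector. Linearity of the projection,
  read from right to left, moves the operations to representatives, where the laws of V
  apply.\<close>

lemma quotient_module_module:
  assumes "module K V" "submodule N K V"
  shows "module K (quotient_module K V N)"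
proof -
  interpret V: module K V by fact
  interpret N: submodule N K V by fact
  interpret S: abelian_subgroup N V
    by (rule submodule_abelian_subgroup) fact+
  let ?Q = "quotient_module K V N"
  note q = linear_mapsD(2,3)[OF quotient_map_linear[OF assms], symmetric]
  note closed = linear_mapsD(1)[OF quotient_map_linear[OF assms]]
  have zero: "\<zero>\<^bsub>?Q\<^esub> = N +>\<^bsub>V\<^esub> \<zero>\<^bsub>V\<^esub>"
    by (simp add: quotient_module_simps S.a_subset)
  show ?thesis
  proof (rule moduleI)
    show "abelian_group ?Q"
    proof (rule abelian_groupI)
      fix X assume "X \<in> carrier ?Q"
      then obtain x where x: "x \<in> carrier V" "X = N +>\<^bsub>V\<^esub> x"
        by (rule quotient_module_carrierE)
      then have "(N +>\<^bsub>V\<^esub> (\<ominus>\<^bsub>V\<^esub> x)) \<oplus>\<^bsub>?Q\<^esub> X = \<zero>\<^bsub>?Q\<^esub>"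
        by (simp add: q zero V.M.l_neg)
      with x(1) closed show "\<exists>Y\<in>carrier ?Q. Y \<oplus>\<^bsub>?Q\<^esub> X = \<zero>\<^bsub>?Q\<^esub>"
        by blast
    qed (auto elim!: quotient_module_carrierE simp: q zero closed V.M.a_ac)
  qed (auto elim!: quotient_module_carrierE simp: q closed V.smult_l_distr V.smult_r_distr
      V.smult_assoc1 intro: V.R.is_cring)
qed

text \<open>The universal property of the quotient. The induced map evaluates f at an arbitrarily
  chosen representative; representatives of one coset differ by an element of N, on which f
  vanishes, so the choice does not matter.\<close>

lemma quotient_lift:
  assumes V: "module K V" and N: "submodule N K V" and W: "module K W"
    and f: "f \<in> linear_maps K V W" and null: "\<And>x. x \<in> N \<Longrightarrow> f x = \<zero>\<^bsub>W\<^esub>"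
  obtains g where "g \<in> linear_maps K (quotient_module K V N) W"
    and "\<And>x. x \<in> carrier V \<Longrightarrow> g (N +>\<^bsub>V\<^esub> x) = f x"
proof -
  interpret V: module K V by fact
  interpret W: module K W by fact
  interpret S: abelian_subgroup N V
    by (rule submodule_abelian_subgroup) fact+
  let ?Q = "quotient_module K V N"
  define g where "g X = f (SOME x. x \<in> X)" for X
  have g: "g (N +>\<^bsub>V\<^esub> x) = f x" if x: "x \<in> carrier V" for x
  proof -
    define y where "y = (SOME y. y \<in> N +>\<^bsub>V\<^esub> x)"
    have "y \<in> N +>\<^bsub>V\<^esub> x"
      unfolding y_def using S.a_rcos_self[OF x] by (rule someI)
    then obtain n where n: "n \<in> N" "y = n \<oplus>\<^bsub>V\<^esub> x"
      by (auto simp: a_r_coset_def')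
    then have "f y = f n \<oplus>\<^bsub>W\<^esub> f x"
      using x S.a_subset by (auto intro: linear_mapsD(2)[OF f])
    then show ?thesis
      using null[OF n(1)] linear_mapsD(1)[OF f x] by (simp add: g_def y_def)
  qed
  note q = linear_mapsD(2,3)[OF quotient_map_linear[OF V N], symmetric]
  have "g \<in> linear_maps K ?Q W"
    by (rule linear_mapsI) (auto elim!: quotient_module_carrierE simp: q g linear_mapsD[OF f])
  with g show thesis
    by (intro that)
qed

lemma quotient_linear_eqI:
  assumes "\<And>x. x \<in> carrier V \<Longrightarrow> f (N +>\<^bsub>V\<^esub> x) = g (N +>\<^bsub>V\<^esub> x)"
    and "X \<in> carrier (quotient_module K V N)"
  shows "f X = g X"
  using assms by (auto elim: quotient_module_carrierE)

section \<open>The universal property of the tensor product\<close>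

text \<open>Additivity and homogeneity in each argument mirror the four families of
  \<open>tensor_relations\<close>, so these are the maps that factor through the tensor
  product.\<close>

definition bilinear_maps ::
  "('k, 'm) ring_scheme \<Rightarrow> ('k, 'v, 'x) module_scheme \<Rightarrow> ('k, 'w, 'y) module_scheme
    \<Rightarrow> ('k, 'u, 'z) module_scheme \<Rightarrow> ('v \<Rightarrow> 'w \<Rightarrow> 'u) set"
  where "bilinear_maps K V W U =
    {b. (\<forall>w\<in>carrier W. (\<lambda>v. b v w) \<in> linear_maps K V U) \<and>
        (\<forall>v\<in>carrier V. b v \<in> linear_maps K W U)}"

lemma bilinear_mapsD:
  assumes "b \<in> bilinear_maps K V W U"
  shows "\<lbrakk>v \<in> carrier V; w \<in> carrier W\<rbrakk> \<Longrightarrow> b v w \<in> carrier U"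
    and "\<lbrakk>v \<in> carrier V; v' \<in> carrier V; w \<in> carrier W\<rbrakk>
      \<Longrightarrow> b (v \<oplus>\<^bsub>V\<^esub> v') w = b v w \<oplus>\<^bsub>U\<^esub> b v' w"
    and "\<lbrakk>v \<in> carrier V; w \<in> carrier W; w' \<in> carrier W\<rbrakk>
      \<Longrightarrow> b v (w \<oplus>\<^bsub>W\<^esub> w') = b v w \<oplus>\<^bsub>U\<^esub> b v w'"
    and "\<lbrakk>c \<in> carrier K; v \<in> carrier V; w \<in> carrier W\<rbrakk> \<Longrightarrow> b (c \<odot>\<^bsub>V\<^esub> v) w = c \<odot>\<^bsub>U\<^esub> b v w"
    and "\<lbrakk>c \<in> carrier K; v \<in> carrier V; w \<in> carrier W\<rbrakk> \<Longrightarrow> b v (c \<odot>\<^bsub>W\<^esub> w) = c \<odot>\<^bsub>U\<^esub> b v w"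
  using assms by (auto simp: bilinear_maps_def linear_maps_def)

lemma tensor_relationsE:
  assumes "r \<in> tensor_relations K V W"
  obtains
    (add_left) v v' w where "v \<in> carrier V" "v' \<in> carrier V" "w \<in> carrier W"
      "r = basis_vec K (v \<oplus>\<^bsub>V\<^esub> v', w) \<ominus>\<^bsub>free_space K (carrier V \<times> carrier W)\<^esub>
        (basis_vec K (v, w) \<oplus>\<^bsub>free_space K (carrier V \<times> carrier W)\<^esub> basis_vec K (v', w))"
  | (add_right) v w w' where "v \<in> carrier V" "w \<in> carrier W" "w' \<in> carrier W"
      "r = basis_vec K (v, w \<oplus>\<^bsub>W\<^esub> w') \<ominus>\<^bsub>free_space K (carrier V \<times> carrier W)\<^esub>
        (basis_vec K (v, w) \<oplus>\<^bsub>free_space K (carrier V \<times> carrier W)\<^esub> basis_vec K (v, w'))"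
  | (smult_left) c v w where "c \<in> carrier K" "v \<in> carrier V" "w \<in> carrier W"
      "r = basis_vec K (c \<odot>\<^bsub>V\<^esub> v, w) \<ominus>\<^bsub>free_space K (carrier V \<times> carrier W)\<^esub>
        c \<odot>\<^bsub>free_space K (carrier V \<times> carrier W)\<^esub> basis_vec K (v, w)"
  | (smult_right) c v w where "c \<in> carrier K" "v \<in> carrier V" "w \<in> carrier W"
      "r = basis_vec K (v, c \<odot>\<^bsub>W\<^esub> w) \<ominus>\<^bsub>free_space K (carrier V \<times> carrier W)\<^esub>
        c \<odot>\<^bsub>free_space K (carrier V \<times> carrier W)\<^esub> basis_vec K (v, w)"
  using assms unfolding tensor_relations_def Let_def by blast

locale module_pair = V: module K V + W: module K W
  for K :: "('k, 'm) ring_scheme" and V :: "('k, 'v, 'x) module_scheme"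
    and W :: "('k, 'w, 'y) module_scheme"
begin

abbreviation "F \<equiv> free_space K (carrier V \<times> carrier W)"

sublocale F: module K F
  by (rule free_space_module) (rule V.R.is_cring)

lemma basis_vec_in_F:
  "\<lbrakk>v \<in> carrier V; w \<in> carrier W\<rbrakk> \<Longrightarrow> basis_vec K (v, w) \<in> carrier F"
  by (rule basis_vec_carrier) (auto intro: V.R.is_cring)

lemma tensor_relations_closed: "tensor_relations K V W \<subseteq> carrier F"
proof
  fix r assume "r \<in> tensor_relations K V W"
  then show "r \<in> carrier F"
    by (cases rule: tensor_relationsE) (simp_all add: basis_vec_in_F)
qed

lemma tensor_null_submodule: "submodule (tensor_null K V W) K F"
  unfolding tensor_null_def
  by (rule submodule_span_submodule) (rule F.module_axioms tensor_relations_closed)+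

lemma tensor_space_module: "module K (tensor_space K V W)"
  unfolding tensor_space_def
  by (rule quotient_module_module) (rule F.module_axioms tensor_null_submodule)+

text \<open>Turns a defining relation into an equation in the tensor product, since the relations
  lie in the submodule that is factored out.\<close>

lemma tensor_null_coset_eqI:
  assumes "x \<ominus>\<^bsub>F\<^esub> y \<in> tensor_relations K V W" "x \<in> carrier F" "y \<in> carrier F"
  shows "tensor_null K V W +>\<^bsub>F\<^esub> x = tensor_null K V W +>\<^bsub>F\<^esub> y"
proof -
  interpret S: abelian_subgroup "tensor_null K V W" F
    by (rule submodule_abelian_subgroup) (rule F.module_axioms tensor_null_submodule)+
  have "x \<oplus>\<^bsub>F\<^esub> \<ominus>\<^bsub>F\<^esub> y \<in> tensor_null K V W"
    using assms(1) submodule_span_superset[of "tensor_relations K V W" K F]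
    by (auto simp: tensor_null_def a_minus_def)
  then have "x \<in> tensor_null K V W +>\<^bsub>F\<^esub> y"
    using assms by (intro S.a_rcos_module_rev)
  then show ?thesis
    using S.a_repr_independence' assms by simp
qed

text \<open>Each of the four laws is one family of \<open>tensor_relations\<close> read as an
  equality of cosets; linearity of the projection then splits the right-hand side.\<close>

lemma elem_tensor_bilinear: "elem_tensor K V W \<in> bilinear_maps K V W (tensor_space K V W)"
proof -
  let ?T = "tensor_space K V W"
  let ?e = "elem_tensor K V W"
  note q = linear_mapsD[OF quotient_map_linear[OF F.module_axioms tensor_null_submodule],
      folded tensor_space_def]
  have "?e (v \<oplus>\<^bsub>V\<^esub> v') w = ?e v w \<oplus>\<^bsub>?T\<^esub> ?e v' w"
    if "v \<in> carrier V" "v' \<in> carrier V" "w \<in> carrier W" for v v' w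
  proof -
    have "basis_vec K (v \<oplus>\<^bsub>V\<^esub> v', w) \<ominus>\<^bsub>F\<^esub> (basis_vec K (v, w) \<oplus>\<^bsub>F\<^esub> basis_vec K (v', w))
        \<in> tensor_relations K V W"
      using that unfolding tensor_relations_def Let_def by blast
    from tensor_null_coset_eqI[OF this] show ?thesis
      using that by (simp add: elem_tensor_def basis_vec_in_F q)
  qed
  moreover have "?e v (w \<oplus>\<^bsub>W\<^esub> w') = ?e v w \<oplus>\<^bsub>?T\<^esub> ?e v w'"
    if "v \<in> carrier V" "w \<in> carrier W" "w' \<in> carrier W" for v w w'
  proof -
    have "basis_vec K (v, w \<oplus>\<^bsub>W\<^esub> w') \<ominus>\<^bsub>F\<^esub> (basis_vec K (v, w) \<oplus>\<^bsub>F\<^esub> basis_vec K (v, w'))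
        \<in> tensor_relations K V W"
      using that unfolding tensor_relations_def Let_def by blast
    from tensor_null_coset_eqI[OF this] show ?thesis
      using that by (simp add: elem_tensor_def basis_vec_in_F q)
  qed
  moreover have "?e (c \<odot>\<^bsub>V\<^esub> v) w = c \<odot>\<^bsub>?T\<^esub> ?e v w"
    if "c \<in> carrier K" "v \<in> carrier V" "w \<in> carrier W" for c v w
  proof -
    have "basis_vec K (c \<odot>\<^bsub>V\<^esub> v, w) \<ominus>\<^bsub>F\<^esub> c \<odot>\<^bsub>F\<^esub> basis_vec K (v, w) \<in> tensor_relations K V W"
      using that unfolding tensor_relations_def Let_def by blast
    from tensor_null_coset_eqI[OF this] show ?thesis
      using that by (simp add: elem_tensor_def basis_vec_in_F q)
  qed
  moreover have "?e v (c \<odot>\<^bsub>W\<^esub> w) = c \<odot>\<^bsub>?T\<^esub> ?e v w"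
    if "c \<in> carrier K" "v \<in> carrier V" "w \<in> carrier W" for c v w
  proof -
    have "basis_vec K (v, c \<odot>\<^bsub>W\<^esub> w) \<ominus>\<^bsub>F\<^esub> c \<odot>\<^bsub>F\<^esub> basis_vec K (v, w) \<in> tensor_relations K V W"
      using that unfolding tensor_relations_def Let_def by blast
    from tensor_null_coset_eqI[OF this] show ?thesis
      using that by (simp add: elem_tensor_def basis_vec_in_F q)
  qed
  moreover have "?e v w \<in> carrier ?T" if "v \<in> carrier V" "w \<in> carrier W" for v w
    using that by (simp add: elem_tensor_def basis_vec_in_F q)
  ultimately show ?thesis
    by (simp add: bilinear_maps_def linear_maps_def)
qed

lemmas elem_tensor_closed = bilinear_mapsD(1)[OF elem_tensor_bilinear]

text \<open>Pure tensors span. Composed with the projection, f and g become linear maps on the free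
  space, and the hypothesis says that they agree on its basis.\<close>

lemma tensor_linear_eqI:
  assumes U: "module K U"
    and f: "f \<in> linear_maps K (tensor_space K V W) U"
    and g: "g \<in> linear_maps K (tensor_space K V W) U"
    and eq: "\<And>v w. \<lbrakk>v \<in> carrier V; w \<in> carrier W\<rbrakk>
      \<Longrightarrow> f (elem_tensor K V W v w) = g (elem_tensor K V W v w)"
    and X: "X \<in> carrier (tensor_space K V W)"
  shows "f X = g X"
proof (rule quotient_linear_eqI)
  note q = quotient_map_linear[OF F.module_axioms tensor_null_submodule, folded tensor_space_def]
  fix x assume "x \<in> carrier F"
  then show "f (tensor_null K V W +>\<^bsub>F\<^esub> x) = g (tensor_null K V W +>\<^bsub>F\<^esub> x)"
    by (rule free_space_linear_eqI[OF V.R.is_cring U linear_maps_comp[OF q f] linear_maps_comp[OF q g], rotated])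
      (auto simp: eq[unfolded elem_tensor_def])
qed (use X in \<open>simp add: tensor_space_def\<close>)

text \<open>Extend b linearly to the free space. Bilinearity puts every defining relation into the
  kernel of the extension; the kernel is a submodule, so it contains \<open>tensor_null\<close>, and
  the extension descends to the quotient.\<close>

lemma tensor_lift:
  assumes U: "module K U" and b: "b \<in> bilinear_maps K V W U"
  obtains m where "m \<in> linear_maps K (tensor_space K V W) U"
    and "\<And>v w. \<lbrakk>v \<in> carrier V; w \<in> carrier W\<rbrakk> \<Longrightarrow> m (elem_tensor K V W v w) = b v w"
proof -
  interpret U: module K U by fact
  let ?f = "free_lift K U (\<lambda>(v, w). b v w)"
  have c: "(\<lambda>(v, w). b v w) \<in> carrier V \<times> carrier W \<rightarrow> carrier U"
    using bilinear_mapsD(1)[OF b] by auto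
  have f: "?f \<in> linear_maps K F U"
    using U c by (rule free_lift_linear)
  have fb: "?f (basis_vec K (v, w)) = b v w" if "v \<in> carrier V" "w \<in> carrier W" for v w
    using free_lift_basis_vec[OF U c, of "(v, w)"] that by simp
  note lin = linear_maps_minus[OF F.module_axioms U f] linear_mapsD[OF f]
  note B = bilinear_mapsD[OF b]
  have "tensor_relations K V W \<subseteq> {x \<in> carrier F. ?f x = \<zero>\<^bsub>U\<^esub>}"
  proof
    fix r assume r: "r \<in> tensor_relations K V W"
    then have "?f r = \<zero>\<^bsub>U\<^esub>"
      by (cases rule: tensor_relationsE)
        (simp_all add: lin fb basis_vec_in_F B a_minus_def[of U] U.M.r_neg)
    with r show "r \<in> {x \<in> carrier F. ?f x = \<zero>\<^bsub>U\<^esub>}"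
      using tensor_relations_closed by auto
  qed
  then have "tensor_null K V W \<subseteq> {x \<in> carrier F. ?f x = \<zero>\<^bsub>U\<^esub>}"
    unfolding tensor_null_def
    by (rule submodule_span_minimal[OF linear_maps_kernel_submodule[OF F.module_axioms U f]])
  then have null: "?f x = \<zero>\<^bsub>U\<^esub>" if "x \<in> tensor_null K V W" for x
    using that by auto
  obtain m where lin_m: "m \<in> linear_maps K (tensor_space K V W) U"
    and m: "\<And>x. x \<in> carrier F \<Longrightarrow> m (tensor_null K V W +>\<^bsub>F\<^esub> x) = ?f x"
    using quotient_lift[OF F.module_axioms tensor_null_submodule U f null]
    unfolding tensor_space_def by blast
  have "m (elem_tensor K V W v w) = b v w" if "v \<in> carrier V" "w \<in> carrier W" for v w
    using that by (simp add: elem_tensor_def m basis_vec_in_F fb)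
  with lin_m show thesis
    by (intro that)
qed

text \<open>The form needed to resolve \<open>comp_mult\<close>. A lift restricted to the carrier
  gives existence; two candidates agree on pure tensors, hence on the carrier, and extensionality
  settles the remaining arguments.\<close>

lemma tensor_lift_ex1:
  assumes U: "module K U" and b: "b \<in> bilinear_maps K V W U"
  shows "\<exists>!m. m \<in> linear_maps K (tensor_space K V W) U \<and>
    m \<in> extensional (carrier (tensor_space K V W)) \<and>
    (\<forall>v\<in>carrier V. \<forall>w\<in>carrier W. m (elem_tensor K V W v w) = b v w)"
proof (rule ex_ex1I)
  let ?T = "tensor_space K V W"
  obtain m where m: "m \<in> linear_maps K ?T U"
    "\<And>v w. \<lbrakk>v \<in> carrier V; w \<in> carrier W\<rbrakk> \<Longrightarrow> m (elem_tensor K V W v w) = b v w"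
    using tensor_lift[OF assms] by blast
  then show "\<exists>m. m \<in> linear_maps K ?T U \<and> m \<in> extensional (carrier ?T) \<and>
      (\<forall>v\<in>carrier V. \<forall>w\<in>carrier W. m (elem_tensor K V W v w) = b v w)"
    by (intro exI[of _ "restrict m (carrier ?T)"])
      (simp add: linear_maps_restrict[OF tensor_space_module] elem_tensor_closed)
next
  fix m n
  assume "m \<in> linear_maps K (tensor_space K V W) U \<and>
      m \<in> extensional (carrier (tensor_space K V W)) \<and>
      (\<forall>v\<in>carrier V. \<forall>w\<in>carrier W. m (elem_tensor K V W v w) = b v w)"
    and "n \<in> linear_maps K (tensor_space K V W) U \<and>
      n \<in> extensional (carrier (tensor_space K V W)) \<and>
      (\<forall>v\<in>carrier V. \<forall>w\<in>carrier W. n (elem_tensor K V W v w) = b v w)"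
  then have mn: "m \<in> linear_maps K (tensor_space K V W) U" "n \<in> linear_maps K (tensor_space K V W) U"
      "m \<in> extensional (carrier (tensor_space K V W))"
      "n \<in> extensional (carrier (tensor_space K V W))"
    and eq: "\<And>v w. \<lbrakk>v \<in> carrier V; w \<in> carrier W\<rbrakk>
      \<Longrightarrow> m (elem_tensor K V W v w) = n (elem_tensor K V W v w)"
    by simp_all
  from mn(3,4) show "m = n"
    by (rule extensionalityI) (rule tensor_linear_eqI[OF U mn(1,2) eq])
qed

end

section \<open>The components of \<open>A[\<pi>]\<close>\<close>

locale component = module K A
  for K :: "('k, 'm) ring_scheme" and A :: "('k, 'a, 'x) module_scheme" +
  fixes \<phi> :: 'p
begin

sublocale line: module K "free_space K {\<phi>}"
  by (rule free_space_module) (rule R.is_cring)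

sublocale T: module_pair K A "free_space K {\<phi>}" ..

lemma comp_space_module: "module K (comp_space K A \<phi>)"
  unfolding comp_space_def by (rule T.tensor_space_module)

lemma comp_elem_linear: "(\<lambda>h. comp_elem K A h \<phi>) \<in> linear_maps K A (comp_space K A \<phi>)"
  using T.elem_tensor_bilinear basis_vec_carrier[OF R.is_cring, of \<phi> "{\<phi>}"]
  unfolding bilinear_maps_def comp_elem_def comp_space_def by blast

lemmas comp_elem_closed = linear_mapsD(1)[OF comp_elem_linear]

text \<open>The line \<open>K\<phi>\<close> being one-dimensional, \<open>h \<otimes> f \<mapsto> f(\<phi>) h\<close> inverts \<open>h \<mapsto> h\<phi>\<close>.\<close>

lemma comp_coordinate:
  obtains c where "c \<in> linear_maps K (comp_space K A \<phi>) A"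
    and "\<And>h. h \<in> carrier A \<Longrightarrow> c (comp_elem K A h \<phi>) = h"
    and "\<And>x. x \<in> carrier (comp_space K A \<phi>) \<Longrightarrow> comp_elem K A (c x) \<phi> = x"
proof -
  let ?L = "free_space K {\<phi>}"
  have coeff: "f \<phi> \<in> carrier K" if "f \<in> carrier ?L" for f
    using that by (simp add: free_space_carrier)
  have e: "basis_vec K \<phi> \<in> carrier ?L"
    by (rule basis_vec_carrier) (simp_all add: R.is_cring)
  have "(\<lambda>h f. f \<phi> \<odot>\<^bsub>A\<^esub> h) \<in> bilinear_maps K A ?L A"
    unfolding bilinear_maps_def
    by (auto intro!: linear_mapsI simp: coeff free_space_simps smult_l_distr smult_r_distr
        smult_assoc1[symmetric] R.m_comm)
  then obtain c where c: "c \<in> linear_maps K (comp_space K A \<phi>) A"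
    and ct: "\<And>h f. \<lbrakk>h \<in> carrier A; f \<in> carrier ?L\<rbrakk> \<Longrightarrow> c (elem_tensor K A ?L h f) = f \<phi> \<odot>\<^bsub>A\<^esub> h"
    using T.tensor_lift[OF module_axioms] unfolding comp_space_def by blast
  have "c (comp_elem K A h \<phi>) = h" if "h \<in> carrier A" for h
    using that e by (simp add: comp_elem_def ct) (simp add: basis_vec_def)
  \<comment> \<open>Both sides are linear in x, so it is enough to compare them on pure
    tensors.\<close>
  moreover have "comp_elem K A (c x) \<phi> = x" if x: "x \<in> carrier (comp_space K A \<phi>)" for x
  proof (rule T.tensor_linear_eqI)
    show "(\<lambda>x. comp_elem K A (c x) \<phi>) \<in> linear_maps K (tensor_space K A ?L) (comp_space K A \<phi>)"
      using linear_maps_comp[OF c comp_elem_linear] by (simp add: comp_space_def)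
    show "(\<lambda>x. x) \<in> linear_maps K (tensor_space K A ?L) (comp_space K A \<phi>)"
      by (rule linear_mapsI) (simp_all add: comp_space_def)
    show "x \<in> carrier (tensor_space K A ?L)"
      using x by (simp add: comp_space_def)
    fix h f assume hf: "h \<in> carrier A" "f \<in> carrier ?L"
    \<comment> \<open>The scalar f(\<phi>) is moved across the tensor sign; as f is supported on
      \<phi>, it equals f(\<phi>) times the basis vector.\<close>
    have "comp_elem K A (f \<phi> \<odot>\<^bsub>A\<^esub> h) \<phi> = elem_tensor K A ?L h (f \<phi> \<odot>\<^bsub>?L\<^esub> basis_vec K \<phi>)"
      using hf coeff e bilinear_mapsD(4,5)[OF T.elem_tensor_bilinear] by (simp add: comp_elem_def)
    also have "f \<phi> \<odot>\<^bsub>?L\<^esub> basis_vec K \<phi> = f"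
    proof
      fix s
      have "f s = \<zero>\<^bsub>K\<^esub>" if "s \<noteq> \<phi>"
        using hf(2) that by (auto simp: free_space_carrier)
      then show "(f \<phi> \<odot>\<^bsub>?L\<^esub> basis_vec K \<phi>) s = f s"
        using coeff[OF hf(2)] by (simp add: free_space_simps basis_vec_def)
    qed
    finally show "comp_elem K A (c (elem_tensor K A ?L h f)) \<phi> = elem_tensor K A ?L h f"
      using hf by (simp add: ct)
  qed (rule comp_space_module)
  ultimately show thesis
    using c by (intro that)
qed

text \<open>The coordinate map is a left inverse. This is what later strips the label \<phi> from an
  identity between components.\<close>

lemma comp_elem_eq_iff:
  "\<lbrakk>h \<in> carrier A; g \<in> carrier A\<rbrakk> \<Longrightarrow> comp_elem K A h \<phi> = comp_elem K A g \<phi> \<longleftrightarrow> h = g"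
  using comp_coordinate by metis

text \<open>The coordinate map supplies preimages. Every vector of the component is thus a single
  \<open>comp_elem\<close>, not just a sum of such, and quantifiers over the component become
  quantifiers over A.\<close>

lemma comp_space_carrier: "carrier (comp_space K A \<phi>) = (\<lambda>h. comp_elem K A h \<phi>) ` carrier A"
proof -
  obtain c where c: "c \<in> linear_maps K (comp_space K A \<phi>) A"
    and "\<And>h. h \<in> carrier A \<Longrightarrow> c (comp_elem K A h \<phi>) = h"
    and inv: "\<And>x. x \<in> carrier (comp_space K A \<phi>) \<Longrightarrow> comp_elem K A (c x) \<phi> = x"
    using comp_coordinate by metis
  have "carrier (comp_space K A \<phi>) \<subseteq> (\<lambda>h. comp_elem K A h \<phi>) ` carrier A"
    using linear_mapsD(1)[OF c] inv[symmetric] by blast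
  then show ?thesis
    using comp_elem_closed by auto
qed

text \<open>The witness is R transported along the isomorphism between A and its \<phi>-component.
  Uniqueness is immediate because each vector of the component is a \<open>comp_elem\<close>, where
  the value is prescribed.\<close>

lemma comp_op_spec:
  assumes R: "R \<in> linear_maps K A A"
  shows "comp_op K A R \<phi> \<in> linear_maps K (comp_space K A \<phi>) (comp_space K A \<phi>)"
    and "h \<in> carrier A \<Longrightarrow> comp_op K A R \<phi> (comp_elem K A h \<phi>) = comp_elem K A (R h) \<phi>"
proof -
  let ?C = "comp_space K A \<phi>"
  let ?P = "\<lambda>r. r \<in> linear_maps K ?C ?C \<and> r \<in> extensional (carrier ?C) \<and>
    (\<forall>h\<in>carrier A. r (comp_elem K A h \<phi>) = comp_elem K A (R h) \<phi>)"
  obtain c where c: "c \<in> linear_maps K ?C A"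
    and ch: "\<And>h. h \<in> carrier A \<Longrightarrow> c (comp_elem K A h \<phi>) = h"
    using comp_coordinate by metis
  have "\<exists>!r. ?P r"
  proof (rule ex_ex1I)
    have "(\<lambda>x. comp_elem K A (R (c x)) \<phi>) \<in> linear_maps K ?C ?C"
      by (rule linear_maps_comp[OF linear_maps_comp[OF c R] comp_elem_linear])
    then show "\<exists>r. ?P r"
      by (intro exI[of _ "\<lambda>x\<in>carrier ?C. comp_elem K A (R (c x)) \<phi>"])
        (simp add: linear_maps_restrict[OF comp_space_module] comp_elem_closed ch)
  next
    fix r s assume rs: "?P r" "?P s"
    then show "r = s"
      by (intro extensionalityI[of r "carrier ?C" s]) (auto simp: comp_space_carrier)
  qed
  then have "?P (comp_op K A R \<phi>)"
    unfolding comp_op_def by (rule theI')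
  then show "comp_op K A R \<phi> \<in> linear_maps K ?C ?C"
    and "h \<in> carrier A \<Longrightarrow> comp_op K A R \<phi> (comp_elem K A h \<phi>) = comp_elem K A (R h) \<phi>"
    by blast+
qed

end

section \<open>The T-algebra structure on the components\<close>

context assoc_algebra
begin

lemma component: "component K A"
  by (rule component.intro) (rule module_axioms)

lemma comp_mult_spec:
  fixes P :: "('p, 'n) monoid_scheme"
  shows "comp_mult K P A p q \<in> linear_maps K (tensor_space K (comp_space K A p) (comp_space K A q))
      (comp_space K A (p \<otimes>\<^bsub>P\<^esub> q))"
    and "\<lbrakk>h \<in> carrier A; g \<in> carrier A\<rbrakk> \<Longrightarrow>
      T_prod K (comp_space K A) (comp_mult K P A) p q (comp_elem K A h p) (comp_elem K A g q)
        = comp_elem K A (h \<otimes>\<^bsub>A\<^esub> g) (p \<otimes>\<^bsub>P\<^esub> q)"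
proof -
  interpret p: component K A p by (rule component)
  interpret q: component K A q by (rule component)
  interpret pq: component K A "p \<otimes>\<^bsub>P\<^esub> q" by (rule component)
  interpret C: module_pair K "comp_space K A p" "comp_space K A q"
    by (intro module_pair.intro p.comp_space_module q.comp_space_module)
  let ?T = "tensor_space K (comp_space K A p) (comp_space K A q)"
  let ?U = "comp_space K A (p \<otimes>\<^bsub>P\<^esub> q)"
  let ?Q = "\<lambda>m. m \<in> linear_maps K ?T ?U \<and> m \<in> extensional (carrier ?T) \<and>
    (\<forall>h\<in>carrier A. \<forall>g\<in>carrier A.
      m (elem_tensor K (comp_space K A p) (comp_space K A q) (comp_elem K A h p) (comp_elem K A g q))
        = comp_elem K A (h \<otimes>\<^bsub>A\<^esub> g) (p \<otimes>\<^bsub>P\<^esub> q))"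
  obtain c where c: "c \<in> linear_maps K (comp_space K A p) A"
    and ch: "\<And>h. h \<in> carrier A \<Longrightarrow> c (comp_elem K A h p) = h"
    using p.comp_coordinate by metis
  obtain d where d: "d \<in> linear_maps K (comp_space K A q) A"
    and dg: "\<And>g. g \<in> carrier A \<Longrightarrow> d (comp_elem K A g q) = g"
    using q.comp_coordinate by metis
  \<comment> \<open>The product of A, read through the coordinates c and d of the two components and
    placed in the component of the product index.\<close>
  define b where "b x y = comp_elem K A (c x \<otimes>\<^bsub>A\<^esub> d y) (p \<otimes>\<^bsub>P\<^esub> q)" for x y
  have "b \<in> bilinear_maps K (comp_space K A p) (comp_space K A q) ?U"
    unfolding bilinear_maps_def b_def
    by (auto intro!: linear_mapsI simp: linear_mapsD[OF c] linear_mapsD[OF d]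
        linear_mapsD(2,3)[OF pq.comp_elem_linear, symmetric] pq.comp_elem_closed mult_closed
        mult_add_left mult_add_right mult_smult_left mult_smult_right)
  \<comment> \<open>The universal property quantifies over all vectors of the two components. By
    \<open>comp_space_carrier\<close> these are the labelled elements of A, which gives the
    condition in \<open>comp_mult\<close>.\<close>
  from C.tensor_lift_ex1[OF pq.comp_space_module this] have "\<exists>!m. ?Q m"
    by (simp add: p.comp_space_carrier q.comp_space_carrier b_def ch dg)
  then have Q: "?Q (comp_mult K P A p q)"
    unfolding comp_mult_def by (rule theI')
  then show "comp_mult K P A p q \<in> linear_maps K ?T ?U"
    by blast
  show "T_prod K (comp_space K A) (comp_mult K P A) p q (comp_elem K A h p) (comp_elem K A g q)
      = comp_elem K A (h \<otimes>\<^bsub>A\<^esub> g) (p \<otimes>\<^bsub>P\<^esub> q)" if "h \<in> carrier A" "g \<in> carrier A"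
    using Q that by (simp add: T_prod_def)
qed

text \<open>On labelled elements both bracketings are again labelled elements: associativity of A
  matches their algebra parts, and associativity of the semigroup matches their indices.\<close>

lemma comp_T_algebra:
  fixes P :: "('p, 'n) monoid_scheme"
  assumes "nonempty_semigroup P"
  shows "T_algebra K P (comp_space K A) (comp_mult K P A)"
proof -
  interpret P: nonempty_semigroup P by fact
  show ?thesis
  proof (intro T_algebra.intro T_algebra_axioms.intro)
    fix p q t a b c
    assume "a \<in> carrier (comp_space K A p)" "b \<in> carrier (comp_space K A q)"
      "c \<in> carrier (comp_space K A t)" and "p \<in> carrier P" "q \<in> carrier P" "t \<in> carrier P"
    then show "T_prod K (comp_space K A) (comp_mult K P A) (p \<otimes>\<^bsub>P\<^esub> q) t
        (T_prod K (comp_space K A) (comp_mult K P A) p q a b) c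
      = T_prod K (comp_space K A) (comp_mult K P A) p (q \<otimes>\<^bsub>P\<^esub> t) a
        (T_prod K (comp_space K A) (comp_mult K P A) q t b c)"
      by (auto simp: component.comp_space_carrier[OF component] comp_mult_spec(2)
          mult_closed mult_assoc P.semi_assoc)
  qed (rule assms comp_mult_spec(1) component.comp_space_module[OF component] K.field_axioms)+
qed

end

theorem theorem2p8:
  fixes K :: "('k, 'm) ring_scheme"
    and P :: "('p, 'n) monoid_scheme"
    and A :: "('k, 'a, 'x) module_scheme"
    and l :: 'k
    and R :: "'a \<Rightarrow> 'a"
  assumes "field K"
    and "nonempty_semigroup P"
    and "assoc_algebra K A"
    and "l \<in> carrier K"
    and "R \<in> linear_maps K A A"
  shows "rota_baxter_algebra K A l R \<longleftrightarrow>
    rota_baxter_T_algebra K P (comp_space K A) (comp_mult K P A) l (comp_op K A R)"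
proof -
  interpret P: nonempty_semigroup P by fact
  interpret A: assoc_algebra K A by fact
  interpret T: T_algebra K P "comp_space K A" "comp_mult K P A"
    using assms(2) by (rule A.comp_T_algebra)
  note elem = linear_mapsD(2,3)[OF component.comp_elem_linear[OF A.component], symmetric]
  note op = component.comp_op_spec[OF A.component assms(5)]
  note R = linear_mapsD[OF assms(5)]
  let ?prod = "T_prod K (comp_space K A) (comp_mult K P A)"
  \<comment> \<open>Both sides evaluate to labelled elements with the same product index. Linearity
    of R distributes it over the sum and the weight term, injectivity removes the label, and
    commutativity of addition swaps the first two summands, which the two identities list in
    opposite order.\<close>
  have key: "?prod p q (comp_op K A R p (comp_elem K A a p)) (comp_op K A R q (comp_elem K A b q))
      = comp_op K A R (p \<otimes>\<^bsub>P\<^esub> q)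
          (?prod p q (comp_op K A R p (comp_elem K A a p)) (comp_elem K A b q)
            \<oplus>\<^bsub>comp_space K A (p \<otimes>\<^bsub>P\<^esub> q)\<^esub>
              ?prod p q (comp_elem K A a p) (comp_op K A R q (comp_elem K A b q))
            \<oplus>\<^bsub>comp_space K A (p \<otimes>\<^bsub>P\<^esub> q)\<^esub>
              l \<odot>\<^bsub>comp_space K A (p \<otimes>\<^bsub>P\<^esub> q)\<^esub> ?prod p q (comp_elem K A a p) (comp_elem K A b q))
      \<longleftrightarrow> R a \<otimes>\<^bsub>A\<^esub> R b = R (a \<otimes>\<^bsub>A\<^esub> R b) \<oplus>\<^bsub>A\<^esub> R (R a \<otimes>\<^bsub>A\<^esub> b) \<oplus>\<^bsub>A\<^esub> l \<odot>\<^bsub>A\<^esub> R (a \<otimes>\<^bsub>A\<^esub> b)"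
    if "a \<in> carrier A" "b \<in> carrier A" for p q a b
    using that assms(4)
    by (simp add: op A.comp_mult_spec(2) R A.mult_closed elem
        component.comp_elem_eq_iff[OF A.component] A.M.a_ac)
  show ?thesis
  proof
    assume "rota_baxter_algebra K A l R"
    then interpret B: rota_baxter_algebra K A l R .
    show "rota_baxter_T_algebra K P (comp_space K A) (comp_mult K P A) l (comp_op K A R)"
    proof (intro rota_baxter_T_algebra.intro rota_baxter_T_algebra_axioms.intro)
      show "T_algebra K P (comp_space K A) (comp_mult K P A)" ..
      fix p q :: 'p and x y
      assume "x \<in> carrier (comp_space K A p)" "y \<in> carrier (comp_space K A q)"
      then obtain a b where "a \<in> carrier A" "x = comp_elem K A a p"
        and "b \<in> carrier A" "y = comp_elem K A b q"
        by (auto simp: component.comp_space_carrier[OF A.component])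
      then show "?prod p q (comp_op K A R p x) (comp_op K A R q y)
        = comp_op K A R (p \<otimes>\<^bsub>P\<^esub> q)
            (?prod p q (comp_op K A R p x) y
              \<oplus>\<^bsub>comp_space K A (p \<otimes>\<^bsub>P\<^esub> q)\<^esub> ?prod p q x (comp_op K A R q y)
              \<oplus>\<^bsub>comp_space K A (p \<otimes>\<^bsub>P\<^esub> q)\<^esub>
                l \<odot>\<^bsub>comp_space K A (p \<otimes>\<^bsub>P\<^esub> q)\<^esub> ?prod p q x y)"
        by (simp only: key B.rota_baxter)
    qed (rule op(1) assms(4))+
  next
    assume "rota_baxter_T_algebra K P (comp_space K A) (comp_mult K P A) l (comp_op K A R)"
    then interpret B: rota_baxter_T_algebra K P "comp_space K A" "comp_mult K P A" l "comp_op K A R" .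
    \<comment> \<open>An index exists since the semigroup is nonempty; it labels both factors a and
      b below.\<close>
    obtain p where p: "p \<in> carrier P"
      using P.semi_nonempty by blast
    show "rota_baxter_algebra K A l R"
    proof (intro rota_baxter_algebra.intro rota_baxter_algebra_axioms.intro)
      fix a b assume ab: "a \<in> carrier A" "b \<in> carrier A"
      with B.rota_baxter[OF p p]
      show "R a \<otimes>\<^bsub>A\<^esub> R b = R (a \<otimes>\<^bsub>A\<^esub> R b) \<oplus>\<^bsub>A\<^esub> R (R a \<otimes>\<^bsub>A\<^esub> b) \<oplus>\<^bsub>A\<^esub> l \<odot>\<^bsub>A\<^esub> R (a \<otimes>\<^bsub>A\<^esub> b)"
        by (intro key[THEN iffD1, of a b p p]) (simp_all add: component.comp_elem_closed[OF A.component])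
    qed (rule assms)+
  qed
qed

end
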